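(* For every integer $n \ge 1$, the Riemann zeta function satisfies $$\zeta(2n) = \frac{1}{2} \lim_{z \to 0} \left( U_{2n}(z) - \frac{1}{z^{2n}} \right), \qquad \text{where } U_{2n}(z) := \sum_{k \in \mathbb{Z}} \frac{1}{k^{2n} + z^{2n}}.$$
   Context: Here $z$ is a complex variable tending to $0$ through nonzero values; for $0<|z|<1$ all denominators $k^{2n}+z^{2n}$ are nonzero. *)

theory Defs
  imports "HOL-Analysis.Analysis"
begin

(* The Riemann zeta function on its half-plane of convergence Re s > 1, where it is given by
   its Dirichlet series. The analytic continuation is not modelled: the values for
   Re s \<le> 1 are not meaningful. *)
definition zeta :: "complex \<Rightarrow> complex"
  where "zeta s = (\<Sum>k. 1 / of_nat (Suc k) powr s)"

(* An unordered sum over all integers; infsum is 0 when the family is not summable. For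
   m = 2 * n with n \<ge> 1 and 0 < norm z < 1 the family is absolutely summable and no
   denominator vanishes. *)
definition U :: "nat \<Rightarrow> complex \<Rightarrow> complex"
  where "U m z = (\<Sum>\<^sub>\<infinity>k\<in>(UNIV :: int set). 1 / (of_int k ^ m + z ^ m))"

end

theory Submission
  imports Defs
begin

text \<open>
  For even \<open>m\<close> the summands at \<open>k\<close> and \<open>-k\<close> agree, and the summand at \<open>k = 0\<close> is exactly \<open>1 / z ^ m\<close>.
  Hence \<open>U m z - 1 / z ^ m\<close> is twice the sum over \<open>k \<ge> 1\<close>, whose terms are dominated by
  \<open>2 / k ^ m\<close> for \<open>norm z \<le> 1 / 2\<close>, so that the limit \<open>z \<rightarrow> 0\<close> may be taken termwise
  (Tannery's theorem).
\<close>

text \<open>The integers split into 0, the positive and the negative ones, and reflection carries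
  the sum over the positive half to the negative half.\<close>

lemma has_sum_int_even:
  fixes f :: "int \<Rightarrow> 'a :: {real_normed_algebra_1}"
  assumes even: "\<And>k. f (- k) = f k"
    and sum: "((\<lambda>k::nat. f (int (Suc k))) has_sum S) UNIV"
  shows "(f has_sum (f 0 + 2 * S)) UNIV"
proof -
  have "(f has_sum S) {1..}"
    using sum
    by (subst has_sum_reindex_bij_witness[of _ "\<lambda>k. int (Suc k)" "\<lambda>k. nat (k - 1)" UNIV
          "\<lambda>k. f (int (Suc k))" _ S]) auto
  moreover from this have "(f has_sum S) {..-1}"
    by (subst has_sum_reindex_bij_witness[of _ uminus uminus "{1..}" f _ S]) (auto simp: even)
  ultimately have "(f has_sum (S + S)) ({1..} \<union> {..-1})"
    by (intro has_sum_Un_disjoint) auto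
  then have "(f has_sum (f 0 + (S + S))) (insert 0 ({1..} \<union> {..-1}))"
    by (intro has_sum_insert) auto
  moreover have "insert 0 ({1..} \<union> {..-1}) = (UNIV :: int set)"
    by auto
  ultimately show ?thesis
    by (simp add: mult_2)
qed

text \<open>Since \<open>norm (z ^ m)\<close> is at most 1/2, adding \<open>z ^ m\<close> removes at
  most half of \<open>real (Suc k) ^ m\<close>. The bound is uniform in \<open>z\<close>, so it
  yields both summability for fixed \<open>z\<close> and the dominating series for the
  limit.\<close>

lemma norm_inverse_power_add_le:
  fixes z :: complex
  assumes "m > 0" and "norm z \<le> 1 / 2"
  shows "norm (1 / (of_nat (Suc k) ^ m + z ^ m)) \<le> 2 / real (Suc k) ^ m"
proof -
  have "norm (z ^ m) \<le> (1 / 2) ^ m"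
    unfolding norm_power using assms by (intro power_mono) auto
  also have "\<dots> \<le> (1 / 2) ^ 1"
    using assms by (intro power_decreasing) auto
  also have "\<dots> \<le> real (Suc k) ^ m / 2"
    using one_le_power[of "real (Suc k)" m] by simp
  finally have "real (Suc k) ^ m / 2 \<le> real (Suc k) ^ m - norm (z ^ m)"
    by simp
  also have "\<dots> \<le> norm (of_nat (Suc k) ^ m + z ^ m)"
    using norm_diff_ineq[of "of_nat (Suc k) ^ m" "z ^ m"] by (simp only: norm_power norm_of_nat)
  finally have "1 / norm (of_nat (Suc k) ^ m + z ^ m) \<le> 1 / (real (Suc k) ^ m / 2)"
    by (intro frac_le) auto
  then show ?thesis
    by (simp add: norm_divide)
qed

lemma summable_inverse_Suc_power:
  assumes "m \<ge> 2"
  shows "summable (\<lambda>k. 2 / real (Suc k) ^ m)"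
proof -
  have "summable (\<lambda>k. 2 * inverse (real (Suc k) ^ m))"
    using assms inverse_power_summable[of m, where 'a = real]
    by (intro summable_mult) (subst summable_Suc_iff, simp)
  then show ?thesis
    by (simp only: divide_inverse)
qed

lemma U_even_eq:
  fixes z :: complex
  assumes "even m" and "m \<ge> 2" and "norm z \<le> 1 / 2"
  shows "U m z = 1 / z ^ m + 2 * (\<Sum>k. 1 / (of_nat (Suc k) ^ m + z ^ m))"
proof -
  let ?f = "\<lambda>k::int. 1 / (of_int k ^ m + z ^ m)"
  let ?g = "\<lambda>k::nat. 1 / (of_nat (Suc k) ^ m + z ^ m)"
  have "summable (\<lambda>k. norm (?g k))"
    by (rule summable_comparison_test[OF _ summable_inverse_Suc_power[OF \<open>m \<ge> 2\<close>]])
      (use assms norm_inverse_power_add_le[of m z] in \<open>auto simp del: of_nat_Suc\<close>)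
  then have "(?g has_sum suminf ?g) UNIV"
    by (intro norm_summable_imp_has_sum summable_sums) (auto intro: summable_norm_cancel)
  then have "((\<lambda>k. ?f (int (Suc k))) has_sum suminf ?g) UNIV"
    by (simp only: of_int_of_nat_eq)
  moreover have "?f (- k) = ?f k" for k
    using \<open>even m\<close> by simp
  ultimately have "(?f has_sum (?f 0 + 2 * suminf ?g)) UNIV"
    by (intro has_sum_int_even)
  \<comment> \<open>The equation includes z = 0: there \<open>?f 0\<close> and
    \<open>1 / z ^ m\<close> are both 0, as division by zero gives 0.\<close>
  then show ?thesis
    using \<open>m \<ge> 2\<close> unfolding U_def by (subst infsumI) (auto simp: power_0_left)
qed

lemma tendsto_suminf_inverse_power_add:
  assumes "m \<ge> 2"
  shows "((\<lambda>z::complex. \<Sum>k. 1 / (of_nat (Suc k) ^ m + z ^ m))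
           \<longlongrightarrow> (\<Sum>k. 1 / of_nat (Suc k) ^ m)) (at 0)"
proof -
  \<comment> \<open>Keeping \<open>0 ^ m\<close> gives the limit the shape that
    \<open>tendsto_intros\<close> produces; the side goal is that the limiting denominator is
    nonzero.\<close>
  have "((\<lambda>z::complex. 1 / (of_nat (Suc k) ^ m + z ^ m))
          \<longlongrightarrow> 1 / (of_nat (Suc k) ^ m + 0 ^ m)) (at 0)" for k
    using assms by (intro tendsto_intros) (simp add: power_0_left del: of_nat_Suc)
  then have lim: "((\<lambda>z::complex. 1 / (of_nat (Suc k) ^ m + z ^ m))
                    \<longlongrightarrow> 1 / of_nat (Suc k) ^ m) (at 0)" for k
    using assms by (simp add: power_0_left del: of_nat_Suc)
  have "eventually (\<lambda>z::complex. norm z \<le> 1 / 2) (at 0)"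
    unfolding eventually_at by (rule exI[of _ "1/2"]) auto
  \<comment> \<open>Tannery's theorem takes its bound along a product filter. The bound holds for
    every \<open>k\<close>, so the first factor contributes only \<open>True\<close>.\<close>
  from eventually_prodI[OF always_eventually this]
  have "eventually (\<lambda>(k, z::complex). norm (1 / (of_nat (Suc k) ^ m + z ^ m))
          \<le> 2 / real (Suc k) ^ m) (at_top \<times>\<^sub>F at 0)"
    by (rule eventually_mono[where P = "\<lambda>p. True \<and> norm (snd p) \<le> 1 / 2"])
      (use assms norm_inverse_power_add_le[of m] in \<open>auto simp del: of_nat_Suc\<close>)
  from tannerys_theorem[OF lim this summable_inverse_Suc_power[OF assms]] show ?thesis
    by simp
qed

theorem corollary2p4:
  fixes n :: nat
  assumes "n \<ge> 1"
  shows "\<exists>L. ((\<lambda>z. U (2 * n) z - 1 / z ^ (2 * n)) \<longlongrightarrow> L) (at 0) \<and>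
             zeta (of_nat (2 * n)) = 1 / 2 * L"
proof (intro exI conjI)
  let ?m = "2 * n"
  have m: "even ?m" "?m \<ge> 2"
    using assms by auto
  have zeta: "zeta (of_nat ?m) = (\<Sum>k. 1 / of_nat (Suc k) ^ ?m)"
    unfolding zeta_def using assms by (subst powr_nat') auto
  have "eventually (\<lambda>z::complex. norm z \<le> 1 / 2) (at 0)"
    unfolding eventually_at by (rule exI[of _ "1/2"]) auto
  then have "eventually (\<lambda>z. 2 * (\<Sum>k. 1 / (of_nat (Suc k) ^ ?m + z ^ ?m))
               = U ?m z - 1 / z ^ ?m) (at 0)"
    by eventually_elim (simp only: U_even_eq[OF m] add_diff_cancel_left')
  moreover have "((\<lambda>z. 2 * (\<Sum>k. 1 / (of_nat (Suc k) ^ ?m + z ^ ?m)))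
                   \<longlongrightarrow> 2 * zeta (of_nat ?m)) (at 0)"
    unfolding zeta by (intro tendsto_intros tendsto_suminf_inverse_power_add m)
  \<comment> \<open>The witness \<open>L\<close>, left open by \<open>exI\<close>, is fixed here as
    \<open>2 * zeta (of_nat ?m)\<close>.\<close>
  ultimately show "((\<lambda>z. U ?m z - 1 / z ^ ?m) \<longlongrightarrow> 2 * zeta (of_nat ?m)) (at 0)"
    by (rule Lim_transform_eventually[rotated])
  show "zeta (of_nat ?m) = 1 / 2 * (2 * zeta (of_nat ?m))"
    by simp
qed

end
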